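(* Let $\mathbb{Z}[i]$ be the Gaussian integers and $\mathcal{E}_{-1} = \{ n \in \mathbb{Z}[i] : |n|^2 \le 2\}$. For every $n \in \mathbb{Z}[i] \setminus \mathcal{E}_{-1}$ there exist nonzero $a,b,c \in \mathbb{Z}[i]$ with $\frac{4}{n} = \frac1a + \frac1b + \frac1c$.
   Context: For $n = x + yi$ with $x,y \in \mathbb{Z}$, $|n|^2 = x^2 + y^2$. *)

theory Defs
  imports Complex_Main
begin

definition gauss_ints :: "complex set" where
  "gauss_ints = {of_int x + of_int y * \<i> | x y :: int. True}"

definition exceptional_set :: "complex set" where
  "exceptional_set = {n \<in> gauss_ints. (cmod n)\<^sup>2 \<le> 2}"

end

theory Submission
  imports Defs
begin

text \<open>
  Write \<open>n = 4 k + w\<close> with a small remainder \<open>w\<close>, so that \<open>4 / n = 1 / k - w / (n k)\<close>.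
  If \<open>w\<close> divides 4, then \<open>w\<close> divides \<open>n\<close> and the last term is a unit fraction. Remainders of norm
  1 and 2 handle all \<open>n\<close> not divisible by 2 except the classes of \<open>\<plusminus>1 + 2\<i>\<close> and \<open>2 \<plusminus> \<i>\<close> modulo 4.
  There \<open>w\<close> can be chosen of norm 5, so \<open>w\<close> divides \<open>k + n = 5 k + w\<close>, and
  \<open>1 / k + 1 / n = (5 k + w) / (n k)\<close> splits \<open>w / (n k)\<close> into two unit fractions.
\<close>

definition egyptian3 :: "complex \<Rightarrow> bool" where
  "egyptian3 z \<longleftrightarrow> (\<exists>a \<in> gauss_ints - {0}. \<exists>b \<in> gauss_ints - {0}. \<exists>c \<in> gauss_ints - {0}.
      z = 1 / a + 1 / b + 1 / c)"

lemma egyptian3I: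
  assumes "a \<in> gauss_ints" "b \<in> gauss_ints" "c \<in> gauss_ints" "a \<noteq> 0" "b \<noteq> 0" "c \<noteq> 0"
    and "z = 1 / a + 1 / b + 1 / c"
  shows "egyptian3 z"
  using assms unfolding egyptian3_def by blast

lemma gauss_int_Complex [intro]: "Complex (of_int x) (of_int y) \<in> gauss_ints"
  unfolding gauss_ints_def by (auto simp: complex_eq_iff)

lemma gauss_intE:
  assumes "z \<in> gauss_ints"
  obtains x y where "z = Complex (of_int x) (of_int y)"
  using assms unfolding gauss_ints_def by (auto simp: complex_eq_iff)

lemma gauss_int_of_int [intro]: "of_int m \<in> gauss_ints"
  using gauss_int_Complex[of m 0] by (simp add: complex_of_real_def[symmetric])

lemma gauss_int_add [intro]:
  assumes "a \<in> gauss_ints" "b \<in> gauss_ints"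
  shows "a + b \<in> gauss_ints"
proof -
  obtain x y u v where "a = Complex (of_int x) (of_int y)" "b = Complex (of_int u) (of_int v)"
    using assms by (elim gauss_intE)
  then have "a + b = Complex (of_int (x + u)) (of_int (y + v))"
    by (simp add: complex_eq_iff)
  then show ?thesis
    using gauss_int_Complex by metis
qed

lemma gauss_int_mult [intro]:
  assumes "a \<in> gauss_ints" "b \<in> gauss_ints"
  shows "a * b \<in> gauss_ints"
proof -
  obtain x y u v where "a = Complex (of_int x) (of_int y)" "b = Complex (of_int u) (of_int v)"
    using assms by (elim gauss_intE)
  then have "a * b = Complex (of_int (x * u - y * v)) (of_int (x * v + y * u))"
    by (simp add: complex_eq_iff)
  then show ?thesis
    using gauss_int_Complex by metis
qed

lemma gauss_int_minus [intro]: "a \<in> gauss_ints \<Longrightarrow> - a \<in> gauss_ints"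
  using gauss_int_mult[OF gauss_int_of_int[of "-1"]] by simp

lemma egyptian3_even:
  assumes "m \<in> gauss_ints" "m \<noteq> 0"
  shows "egyptian3 (4 / (2 * m))"
proof (rule egyptian3I[of m "2 * m" "2 * m"])
  have "2 * m \<in> gauss_ints"
    using gauss_int_mult[OF gauss_int_of_int[of 2] assms(1)] by simp
  then show "2 * m \<in> gauss_ints" "2 * m \<in> gauss_ints"
    by simp_all
  show "4 / (2 * m) = 1 / m + 1 / (2 * m) + 1 / (2 * m)"
    using assms(2) by (simp add: divide_simps)
qed (use assms in auto)

text \<open>Since \<open>w * r = 4\<close>, the number \<open>n = 4 * k + w\<close> factors as
  \<open>w * (r * k + 1)\<close>. Cancelling \<open>w\<close> turns \<open>w / (n * k)\<close> into
  \<open>1 / (k * (r * k + 1))\<close>.\<close>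

lemma egyptian3_remainder_dvd_4:
  assumes "k \<in> gauss_ints" "r \<in> gauss_ints" and wr: "w * r = 4"
    and k: "k \<noteq> 0" and n: "4 * k + w \<noteq> 0"
  shows "egyptian3 (4 / (4 * k + w))"
proof (rule egyptian3I)
  have eq: "4 * k + w = w * (r * k + 1)"
    unfolding wr[symmetric] by (simp add: algebra_simps)
  then have nz: "w \<noteq> 0" "r * k + 1 \<noteq> 0"
    using n by auto
  \<comment> \<open>The identity gives only two unit fractions, so \<open>1 / k\<close> is split
    into two equal halves to obtain three.\<close>
  show "2 * k \<in> gauss_ints" "2 * k \<in> gauss_ints"
    using assms gauss_int_of_int[of 2] by auto
  show "- (k * (r * k + 1)) \<in> gauss_ints"
    using assms gauss_int_of_int[of 1] by auto
  show "- (k * (r * k + 1)) \<noteq> 0"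
    using nz k by auto
  have "4 / (4 * k + w) = r / (r * k + 1)"
    unfolding eq using nz(1) by (simp flip: wr)
  then show "4 / (4 * k + w) = 1 / (2 * k) + 1 / (2 * k) + 1 / - (k * (r * k + 1))"
    using nz k by (simp add: divide_simps)
qed (use k in auto)

text \<open>The quotient of \<open>k + n = 5 * k + w\<close> by \<open>w\<close> is
  \<open>v * k + 1\<close>. The last hypothesis therefore says that \<open>k + n\<close> is nonzero,
  which keeps the two new denominators nonzero.\<close>

lemma egyptian3_remainder_dvd_5:
  assumes "k \<in> gauss_ints" "v \<in> gauss_ints" "w \<in> gauss_ints" and wv: "w * v = 5"
    and k: "k \<noteq> 0" and n: "4 * k + w \<noteq> 0" and v: "v * k + 1 \<noteq> 0"
  shows "egyptian3 (4 / (4 * k + w))"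
proof (rule egyptian3I)
  let ?n = "4 * k + w"
  let ?g = "v * k + 1"
  have w: "w \<noteq> 0" and wg: "w * ?g = k + ?n"
    using wv by (auto simp: algebra_simps)
  have n_int: "?n \<in> gauss_ints" and g_int: "?g \<in> gauss_ints"
    using assms gauss_int_of_int[of 4] gauss_int_of_int[of 1] by auto
  show "k \<in> gauss_ints" "- (k * ?g) \<in> gauss_ints" "- (?n * ?g) \<in> gauss_ints"
    using assms n_int g_int by auto
  show "k \<noteq> 0" "- (k * ?g) \<noteq> 0" "- (?n * ?g) \<noteq> 0"
    using k n v by auto
  have "1 / (k * ?g) + 1 / (?n * ?g) = (k + ?n) / (k * ?n * ?g)"
    using k n v by (simp add: divide_simps)
  also have "\<dots> = w / (k * ?n)"
    unfolding wg[symmetric] using v by simp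
  also have "\<dots> = 1 / k - 4 / ?n"
    using k n by (simp add: divide_simps)
  finally have "4 / ?n = 1 / k - 1 / (k * ?g) - 1 / (?n * ?g)"
    by (simp only: diff_diff_eq eq_diff_eq add.commute)
  then show "4 / ?n = 1 / k + 1 / - (k * ?g) + 1 / - (?n * ?g)"
    by (simp only: minus_divide_right[symmetric] diff_conv_add_uminus)
qed

lemma egyptian3_norm_dvd_4:
  fixes p q s t :: int
  assumes st: "(s\<^sup>2 + t\<^sup>2) dvd 4" and k: "(p, q) \<noteq> (0, 0)"
    and n: "(4 * p + s, 4 * q + t) \<noteq> (0, 0)"
  shows "egyptian3 (4 / Complex (of_int (4 * p + s)) (of_int (4 * q + t)))"
proof -
  obtain m where m: "4 = (s\<^sup>2 + t\<^sup>2) * m"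
    using st by (elim dvdE)
  let ?k = "Complex p q"
  let ?w = "Complex s t"
  \<comment> \<open>This is \<open>m\<close> times the conjugate of \<open>?w\<close>, so its
    product with \<open>?w\<close> is \<open>m\<close> times the norm of \<open>?w\<close>, which is
    4.\<close>
  let ?r = "Complex (of_int (m * s)) (of_int (- (m * t)))"
  have eq: "Complex (of_int (4 * p + s)) (of_int (4 * q + t)) = 4 * ?k + ?w"
    by (simp add: complex_eq_iff)
  have "real_of_int ((s\<^sup>2 + t\<^sup>2) * m) = 4"
    unfolding m[symmetric] by simp
  then have wr: "?w * ?r = 4"
    by (simp add: complex_eq_iff power2_eq_square algebra_simps)
  have n': "4 * ?k + ?w \<noteq> 0"
    unfolding eq[symmetric] using n by (auto simp: complex_eq_iff simp del: of_int_add)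
  show ?thesis
    unfolding eq by (rule egyptian3_remainder_dvd_4[OF _ _ wr _ n'])
      (use k in \<open>auto simp: complex_eq_iff simp del: of_int_minus of_int_mult\<close>)
qed

lemma egyptian3_norm_5:
  fixes p q s t :: int
  assumes st: "s\<^sup>2 + t\<^sup>2 = 5" and k: "(p, q) \<noteq> (0, 0)"
  shows "egyptian3 (4 / Complex (of_int (4 * p + s)) (of_int (4 * q + t)))"
proof -
  let ?k = "Complex p q"
  let ?w = "Complex s t"
  let ?v = "Complex (of_int s) (of_int (- t))"
  have eq: "Complex (of_int (4 * p + s)) (of_int (4 * q + t)) = 4 * ?k + ?w"
    by (simp add: complex_eq_iff)
  have "real_of_int (s\<^sup>2 + t\<^sup>2) = 5"
    unfolding st by simp
  then have wv: "?w * ?v = 5"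
    by (simp add: complex_eq_iff power2_eq_square algebra_simps)
  \<comment> \<open>If \<open>n\<close> vanished, \<open>w\<close> would be \<open>-4 * k\<close>;
    if \<open>v * k + 1\<close> vanished, multiplying by \<open>w\<close> would give
    \<open>w = -5 * k\<close>. Both are impossible, because neither 16 nor 25 divides the norm 5 of
    \<open>w\<close>.\<close>
  have not_multiple: "\<not> (s = c * p \<and> t = c * q)" if "c\<^sup>2 \<in> {16, 25}" for c
  proof
    assume "s = c * p \<and> t = c * q"
    then have "c\<^sup>2 * (p\<^sup>2 + q\<^sup>2) = 5"
      using st by (simp add: power_mult_distrib algebra_simps)
    with that show False
      by auto presburger+
  qed
  have n: "4 * ?k + ?w \<noteq> 0"
    unfolding eq[symmetric] using not_multiple[of "-4"]
    by (auto simp: complex_eq_iff simp del: of_int_add)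
  have v: "?v * ?k + 1 \<noteq> 0"
  proof
    assume "?v * ?k + 1 = 0"
    then have "?w * ?v * ?k + ?w = 0"
      by (metis distrib_left mult.assoc mult.right_neutral mult_zero_right)
    then have "real_of_int s = of_int (- 5 * p)" "real_of_int t = of_int (- 5 * q)"
      unfolding wv by (simp_all add: complex_eq_iff)
    then show False
      using not_multiple[of "-5"] by (simp only: of_int_eq_iff) simp
  qed
  show ?thesis
    unfolding eq by (rule egyptian3_remainder_dvd_5[OF _ _ _ wv _ n v])
      (use k in \<open>auto simp: complex_eq_iff simp del: of_int_minus\<close>)
qed

text \<open>The multiple of 4 nearest to \<open>n\<close> may be 0, but a remainder 2 can be traded for \<open>-2\<close>.\<close>

lemma egyptian3_odd_2:
  fixes p q s :: int
  assumes s: "s\<^sup>2 = 1"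
  shows "egyptian3 (4 / Complex (of_int (4 * p + s)) (of_int (4 * q + 2)))"
    and "egyptian3 (4 / Complex (of_int (4 * q + 2)) (of_int (4 * p + s)))"
proof -
  obtain q' t :: int where t: "4 * q + 2 = 4 * q' + t" "t\<^sup>2 = 4" "q' \<noteq> 0"
  proof (cases "q = 0")
    case True
    then show ?thesis using that[of 1 "-2"] by simp
  next
    case False
    then show ?thesis using that[of q 2] by simp
  qed
  show "egyptian3 (4 / Complex (of_int (4 * p + s)) (of_int (4 * q + 2)))"
    unfolding t(1) using s t by (intro egyptian3_norm_5) auto
  show "egyptian3 (4 / Complex (of_int (4 * q + 2)) (of_int (4 * p + s)))"
    unfolding t(1) using s t by (intro egyptian3_norm_5) auto
qed

text \<open>Taking -1 instead of 3 as a residue makes every odd remainder have square 1, which keeps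
  the norms of the remainders small.\<close>

lemma remainder_mod_4:
  fixes x :: int
  obtains p s where "x = 4 * p + s" "s \<in> {-1, 0, 1, 2}"
proof -
  have "\<exists>p. x = 4 * p - 1 \<or> x = 4 * p \<or> x = 4 * p + 1 \<or> x = 4 * p + 2"
    by presburger
  then show ?thesis
    using that[of _ "-1"] that[of _ 0] that[of _ 1] that[of _ 2] by auto
qed

lemma egyptian3_norm_gt_2:
  fixes x y :: int
  assumes norm: "x\<^sup>2 + y\<^sup>2 > 2"
  shows "egyptian3 (4 / Complex (of_int x) (of_int y))"
proof -
  obtain p s where x: "x = 4 * p + s" and s: "s \<in> {-1, 0, 1, 2}"
    by (rule remainder_mod_4)
  obtain q t where y: "y = 4 * q + t" and t: "t \<in> {-1, 0, 1, 2}"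
    by (rule remainder_mod_4)
  have nz: "(x, y) \<noteq> (0, 0)"
    using norm by auto
  \<comment> \<open>Once the even pairs and the pairs of an odd residue with 2 are set aside, what
    remains is an odd residue paired with 0 (norm 1) or two odd residues (norm 2).\<close>
  consider "even s" "even t" | "s\<^sup>2 = 1" "t = 2" | "t\<^sup>2 = 1" "s = 2"
    | "s\<^sup>2 + t\<^sup>2 = 1 \<or> s\<^sup>2 + t\<^sup>2 = 2"
    using s t by auto
  then show ?thesis
  proof cases
    case 1
    then obtain x' y' where xy: "x = 2 * x'" "y = 2 * y'"
      using x y by (metis dvd_add dvd_mult2 even_numeral evenE)
    then have "Complex (of_int x) (of_int y) = 2 * Complex x' y'"
      by (simp add: complex_eq_iff)
    moreover have "Complex x' y' \<noteq> 0"
      using nz xy by (auto simp: complex_eq_iff)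
    ultimately show ?thesis
      using egyptian3_even gauss_int_Complex by metis
  next
    case 2
    then show ?thesis unfolding x y by (metis egyptian3_odd_2(1))
  next
    case 3
    then show ?thesis unfolding x y by (metis egyptian3_odd_2(2))
  next
    case 4
    then have "(s\<^sup>2 + t\<^sup>2) dvd 4"
      by auto
    \<comment> \<open>If \<open>p\<close> and \<open>q\<close> were both 0, \<open>n\<close> would
      equal its remainder, of norm at most 2. This is where the exceptional set has to be
      excluded.\<close>
    moreover have "(p, q) \<noteq> (0, 0)"
      using 4 norm x y by auto
    ultimately show ?thesis
      using nz unfolding x y by (rule egyptian3_norm_dvd_4)
  qed
qed

theorem theorem10:
  shows "\<forall>n \<in> gauss_ints - exceptional_set.
    \<exists>a \<in> gauss_ints - {0}. \<exists>b \<in> gauss_ints - {0}. \<exists>c \<in> gauss_ints - {0}.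
      4 / n = 1 / a + 1 / b + 1 / c"
proof
  fix n assume n: "n \<in> gauss_ints - exceptional_set"
  then obtain x y where xy: "n = Complex (of_int x) (of_int y)"
    by (auto elim: gauss_intE)
  have "(cmod n)\<^sup>2 > 2"
    using n unfolding exceptional_set_def by auto
  then have "real_of_int (x\<^sup>2 + y\<^sup>2) > of_int 2"
    unfolding xy by (simp add: cmod_power2)
  then have "x\<^sup>2 + y\<^sup>2 > 2"
    by (simp only: of_int_less_iff)
  then show "\<exists>a \<in> gauss_ints - {0}. \<exists>b \<in> gauss_ints - {0}. \<exists>c \<in> gauss_ints - {0}.
      4 / n = 1 / a + 1 / b + 1 / c"
    using egyptian3_norm_gt_2 unfolding xy egyptian3_def by blast
qed

end
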